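(* If $S$ is a finite S-semigroup and $p$ is a prime dividing $|S|$, it does not follow that $S$ has a Smarandache $p$-Sylow subgroup; that is, there exist a finite S-semigroup $S$ and a prime $p$ dividing $|S|$ such that $S$ has no Smarandache $p$-Sylow subgroup.
   Context: An S-semigroup (Smarandache semigroup) is a semigroup $S$ having a proper subset $A \subsetneq S$ that is a group with respect to the operation of $S$ (its identity need not be an identity of $S$). Following the paper's usage, a one-element group is not counted. A "subgroup of $S$" means such a proper subset (with at least two elements). For a finite S-semigroup $S$ and a prime $p$ dividing $|S|$, a Smarandache $p$-Sylow subgroup of $S$ is a subgroup of $S$ of order $p^t$ for some integer $t \ge 1$ (it is not required that $p^t$ divide $|S|$). *)

theory Defs
  imports "HOL-Algebra.Group" "HOL-Computational_Algebra.Primes"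
begin

text \<open>
  A semigroup is given by a carrier set and a binary operation, of which only the values on
  the carrier matter. Nonemptiness is not demanded here; it follows from
  \<open>S_semigroup\<close> below.
\<close>

definition is_semigroup :: "'a set \<Rightarrow> ('a \<Rightarrow> 'a \<Rightarrow> 'a) \<Rightarrow> bool" where
  "is_semigroup S f \<longleftrightarrow>
     (\<forall>x\<in>S. \<forall>y\<in>S. f x y \<in> S) \<and>
     (\<forall>x\<in>S. \<forall>y\<in>S. \<forall>z\<in>S. f (f x y) z = f x (f y z))"

text \<open>
  The identity \<open>e\<close> of the group \<open>A\<close> need not be an identity of \<open>S\<close>, so it is
  quantified separately for each \<open>A\<close>. One-element groups do not count as subgroups, and
  neither does \<open>S\<close> itself, even when \<open>S\<close> is a group.
\<close>

definition S_subgroup :: "'a set \<Rightarrow> 'a set \<Rightarrow> ('a \<Rightarrow> 'a \<Rightarrow> 'a) \<Rightarrow> bool" where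
  "S_subgroup A S f \<longleftrightarrow>
     A \<subset> S \<and>
     (\<exists>e. group \<lparr>carrier = A, monoid.mult = f, one = e\<rparr>) \<and>
     (\<exists>x\<in>A. \<exists>y\<in>A. x \<noteq> y)"

definition S_semigroup :: "'a set \<Rightarrow> ('a \<Rightarrow> 'a \<Rightarrow> 'a) \<Rightarrow> bool" where
  "S_semigroup S f \<longleftrightarrow> is_semigroup S f \<and> (\<exists>A. S_subgroup A S f)"

definition smarandache_sylow_subgroup ::
    "nat \<Rightarrow> 'a set \<Rightarrow> 'a set \<Rightarrow> ('a \<Rightarrow> 'a \<Rightarrow> 'a) \<Rightarrow> bool" where
  "smarandache_sylow_subgroup p P S f \<longleftrightarrow>
     S_subgroup P S f \<and> (\<exists>t\<ge>1. card P = p ^ t)"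

end

theory Submission
  imports Defs
begin

text \<open>
  A Smarandache \<open>p\<close>-Sylow subgroup is a proper subset of \<open>S\<close> with at least \<open>p\<close> elements. If \<open>S\<close>
  has exactly \<open>p\<close> elements there is no room for one, although \<open>p\<close> divides \<open>card S\<close>. The
  residues modulo \<open>3\<close> under multiplication are such an S-semigroup with \<open>p = 3\<close>: the units
  \<open>1, 2\<close> form a proper group of order \<open>2\<close>.
\<close>

lemma no_smarandache_sylow_subgroup_if_card_le:
  assumes "finite S" and "p > 0" and "card S \<le> p"
  shows "\<not> smarandache_sylow_subgroup p P S f"
proof
  assume "smarandache_sylow_subgroup p P S f"
  then obtain t where "P \<subset> S" "t \<ge> 1" "card P = p ^ t"
    by (auto simp: smarandache_sylow_subgroup_def S_subgroup_def)
  moreover from \<open>P \<subset> S\<close> have "card P < p"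
    by (rule psubset_card_mono[OF assms(1), THEN less_le_trans, OF _ assms(3)])
  moreover have "p \<le> p ^ t"
    using \<open>t \<ge> 1\<close> assms(2) by (simp add: self_le_power)
  ultimately show False by simp
qed

lemma S_subgroupI:
  assumes "group \<lparr>carrier = A, monoid.mult = f, one = e\<rparr>"
    and "A \<subset> S" and "x \<in> A" and "y \<in> A" and "x \<noteq> y"
  shows "S_subgroup A S f"
  unfolding S_subgroup_def using assms by blast

lemma units_S_subgroup_mult_mod_3:
  "S_subgroup {1, 2} {0, 1, 2 :: nat} (\<lambda>x y. x * y mod 3)"
proof -
  let ?G = "\<lparr>carrier = {1, 2}, monoid.mult = (\<lambda>x y :: nat. x * y mod 3), one = 1\<rparr>"
  have "group ?G"
  proof (rule groupI)
    show "\<exists>y\<in>carrier ?G. y \<otimes>\<^bsub>?G\<^esub> x = \<one>\<^bsub>?G\<^esub>" if "x \<in> carrier ?G" for x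
      \<comment> \<open>each unit modulo \<open>3\<close> is its own inverse\<close>
      using that by (intro bexI[of _ x]) auto
  qed auto
  then show ?thesis
    by (rule S_subgroupI[where x = 1 and y = 2]) (simp_all add: psubset_insert_iff)
qed

lemma S_semigroup_mult_mod_3:
  "S_semigroup {0, 1, 2 :: nat} (\<lambda>x y. x * y mod 3)"
  unfolding S_semigroup_def is_semigroup_def
  by (intro conjI exI[of _ "{1, 2}"] units_S_subgroup_mult_mod_3) auto

theorem theorem5p4p1:
  shows "\<exists>(S :: nat set) (f :: nat \<Rightarrow> nat \<Rightarrow> nat) (p :: nat).
           finite S \<and> S_semigroup S f \<and> prime p \<and> p dvd card S \<and>
           \<not> (\<exists>P. smarandache_sylow_subgroup p P S f)"
proof (intro exI conjI)
  show "S_semigroup {0, 1, 2 :: nat} (\<lambda>x y. x * y mod 3)"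
    by (rule S_semigroup_mult_mod_3)
  show "prime (3 :: nat)"
    by simp
  show "\<not> (\<exists>P. smarandache_sylow_subgroup 3 P {0, 1, 2 :: nat} (\<lambda>x y. x * y mod 3))"
    by (simp add: no_smarandache_sylow_subgroup_if_card_le)
  show "3 dvd card {0, 1, 2 :: nat}"
    by (simp add: numeral_3_eq_3)
qed simp

end
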